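(* Let $M$ be a finite-dimensional complex left central Leibniz algebra with radical $R$, let $\mathcal{L}$ be the set of Lie subalgebras of $M$, and let $L\subseteq M$ be a Leibniz subalgebra. Then the following are equivalent: (a) $L\in\mathcal{L}$; (b) $L$ is a totally isotropic subspace; (c) $L+R\in\mathcal{L}$.
   Context: A left Leibniz algebra is a (nonassociative) $\mathbb{C}$-algebra $M$ with product $[\ ]$ satisfying $[a[bc]]=[[ab]c]+[b[ac]]$ for all $a,b,c\in M$. It is left central if in addition $[a[bb]]=0$ for all $a,b\in M$. All algebras are finite-dimensional over $\mathbb{C}$. A Leibniz subalgebra is a subspace closed under $[\ ]$; a Lie subalgebra is a Leibniz subalgebra which is a Lie algebra under $[\ ]$. Let $\psi(a,b)=[ab]+[ba]$. A subspace $U\subseteq M$ is totally isotropic if $\psi(a,b)=0$ for all $a,b\in U$. The radical is $R=\{x\in M\mid\psi(x,a)=0\text{ for all }a\in M\}$. *)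

theory Defs
  imports Complex_Main "HOL-Library.Set_Algebras"
begin

text \<open>
  An algebra is the whole type \<open>'a\<close>, with scalar multiplication \<open>scale\<close> and product \<open>br\<close>;
  subalgebras are subsets of it.
\<close>

locale complex_algebra = vector_space scale
  for scale :: "complex \<Rightarrow> 'a::ab_group_add \<Rightarrow> 'a" +
  fixes br :: "'a \<Rightarrow> 'a \<Rightarrow> 'a"
  assumes linear_left: "Vector_Spaces.linear scale scale (\<lambda>a. br a b)"
    and linear_right: "Vector_Spaces.linear scale scale (\<lambda>b. br a b)"
    and finite_dim: "\<exists>B. finite B \<and> span B = UNIV"

locale left_leibniz_algebra = complex_algebra +
  assumes left_leibniz: "br a (br b c) = br (br a b) c + br b (br a c)"

locale left_central_leibniz_algebra = left_leibniz_algebra +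
  assumes left_central: "br a (br b b) = 0"

locale lie_algebra_on = vector_space scale
  for scale :: "complex \<Rightarrow> 'a::ab_group_add \<Rightarrow> 'a"
    and br :: "'a \<Rightarrow> 'a \<Rightarrow> 'a"
    and S :: "'a set" +
  assumes carrier_subspace: "subspace S"
    and closed: "\<lbrakk>a \<in> S; b \<in> S\<rbrakk> \<Longrightarrow> br a b \<in> S"
    and add_left: "\<lbrakk>a \<in> S; b \<in> S; c \<in> S\<rbrakk> \<Longrightarrow> br (a + b) c = br a c + br b c"
    and add_right: "\<lbrakk>a \<in> S; b \<in> S; c \<in> S\<rbrakk> \<Longrightarrow> br a (b + c) = br a b + br a c"
    and scale_left: "\<lbrakk>a \<in> S; b \<in> S\<rbrakk> \<Longrightarrow> br (scale r a) b = scale r (br a b)"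
    and scale_right: "\<lbrakk>a \<in> S; b \<in> S\<rbrakk> \<Longrightarrow> br a (scale r b) = scale r (br a b)"
    and alternating: "a \<in> S \<Longrightarrow> br a a = 0"
    and jacobi: "\<lbrakk>a \<in> S; b \<in> S; c \<in> S\<rbrakk> \<Longrightarrow>
      br a (br b c) + br b (br c a) + br c (br a b) = 0"

definition leibniz_subalgebra ::
    "(complex \<Rightarrow> 'a::ab_group_add \<Rightarrow> 'a) \<Rightarrow> ('a \<Rightarrow> 'a \<Rightarrow> 'a) \<Rightarrow> 'a set \<Rightarrow> bool" where
  "leibniz_subalgebra scale br S \<longleftrightarrow>
     module.subspace scale S \<and> (\<forall>a\<in>S. \<forall>b\<in>S. br a b \<in> S)"

definition lie_subalgebras ::
    "(complex \<Rightarrow> 'a::ab_group_add \<Rightarrow> 'a) \<Rightarrow> ('a \<Rightarrow> 'a \<Rightarrow> 'a) \<Rightarrow> 'a set set" where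
  "lie_subalgebras scale br = {S. leibniz_subalgebra scale br S \<and> lie_algebra_on scale br S}"

definition psi :: "('a::ab_group_add \<Rightarrow> 'a \<Rightarrow> 'a) \<Rightarrow> 'a \<Rightarrow> 'a \<Rightarrow> 'a" where
  "psi br a b = br a b + br b a"

definition totally_isotropic_subspace ::
    "(complex \<Rightarrow> 'a::ab_group_add \<Rightarrow> 'a) \<Rightarrow> ('a \<Rightarrow> 'a \<Rightarrow> 'a) \<Rightarrow> 'a set \<Rightarrow> bool" where
  "totally_isotropic_subspace scale br U \<longleftrightarrow>
     module.subspace scale U \<and> (\<forall>a\<in>U. \<forall>b\<in>U. psi br a b = 0)"

definition radical :: "('a::ab_group_add \<Rightarrow> 'a \<Rightarrow> 'a) \<Rightarrow> 'a set" where
  "radical br = {x. \<forall>a. psi br x a = 0}"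

end

theory Submission
  imports Defs
begin

text \<open>
  On a subalgebra the Leibniz identity becomes the Jacobi identity as soon as the product is
  antisymmetric there, so being Lie amounts to \<open>\<psi>\<close> vanishing. Left multiplications are
  derivations with respect to \<open>\<psi>\<close>, which makes the radical \<open>R\<close> an ideal; hence \<open>L + R\<close> is again
  a subalgebra, and it is totally isotropic exactly when \<open>L\<close> is.
\<close>

context complex_algebra
begin

lemma br_add_left: "br (a + b) c = br a c + br b c"
  by (rule module_hom.add[OF Vector_Spaces.linear.axioms(3)[OF linear_left]])

lemma br_add_right: "br a (b + c) = br a b + br a c"
  by (rule module_hom.add[OF Vector_Spaces.linear.axioms(3)[OF linear_right]])

lemma br_scale_left: "br (scale r a) b = scale r (br a b)"
  by (rule module_hom.scale[OF Vector_Spaces.linear.axioms(3)[OF linear_left]])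

lemma br_scale_right: "br a (scale r b) = scale r (br a b)"
  by (rule module_hom.scale[OF Vector_Spaces.linear.axioms(3)[OF linear_right]])

lemma br_zero_left: "br 0 a = 0"
  using br_scale_left[of 0 0 a] by simp

lemma br_zero_right: "br a 0 = 0"
  using br_scale_right[of a 0 0] by simp

lemma psi_commute: "psi br a b = psi br b a"
  by (simp add: psi_def add.commute)

lemma psi_add_left: "psi br (a + b) c = psi br a c + psi br b c"
  by (simp add: psi_def br_add_left br_add_right algebra_simps)

lemma psi_add_right: "psi br a (b + c) = psi br a b + psi br a c"
  by (simp add: psi_def br_add_left br_add_right algebra_simps)

lemma psi_scale_left: "psi br (scale r a) b = scale r (psi br a b)"
  by (simp add: psi_def br_scale_left br_scale_right scale_right_distrib)

text \<open>On the diagonal \<open>psi\<close> is twice the square, and 2 is invertible in the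
  complex numbers. This is the bridge from isotropy to the alternating law of a Lie algebra.\<close>

lemma psi_self_eq_0_iff: "psi br a a = 0 \<longleftrightarrow> br a a = 0"
proof -
  have "psi br a a = scale 2 (br a a)"
    using scale_left_distrib[of 1 1 "br a a"] by (simp add: psi_def)
  then show ?thesis by simp
qed

lemma psi_radical:
  assumes "x \<in> radical br"
  shows "psi br x a = 0" and "psi br a x = 0"
  using assms psi_commute[of a x] by (simp_all add: radical_def)

lemma subspace_radical: "subspace (radical br)"
proof (rule subspaceI)
  show "0 \<in> radical br"
    by (simp add: radical_def psi_def br_zero_left br_zero_right)
qed (simp_all add: radical_def psi_add_left psi_scale_left)

lemma subspace_set_plus:
  assumes "subspace U" and "subspace V"
  shows "subspace (U + V)"
proof -
  have "U + V = {x + y | x y. x \<in> U \<and> y \<in> V}"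
    by (auto simp: set_plus_def)
  then show ?thesis
    using subspace_sums[OF assms] by simp
qed

text \<open>Expanding \<open>psi\<close> bilinearly on \<open>a + x\<close> and \<open>b + y\<close>
  with \<open>x\<close>, \<open>y\<close> in the radical leaves only \<open>psi br a b\<close>.
  Conversely, isotropy passes to subspaces, and \<open>L\<close> lies in the sum because the radical
  contains 0.\<close>

lemma totally_isotropic_add_radical_iff:
  assumes "subspace L"
  shows "totally_isotropic_subspace scale br (L + radical br) \<longleftrightarrow>
    totally_isotropic_subspace scale br L"
proof
  assume iso: "totally_isotropic_subspace scale br (L + radical br)"
  have "L \<subseteq> L + radical br"
    using set_zero_plus2[OF subspace_0[OF subspace_radical], of L] by (simp add: add.commute)
  then show "totally_isotropic_subspace scale br L"
    using iso assms unfolding totally_isotropic_subspace_def by blast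
next
  assume "totally_isotropic_subspace scale br L"
  then show "totally_isotropic_subspace scale br (L + radical br)"
    by (auto simp: totally_isotropic_subspace_def subspace_set_plus subspace_radical
        psi_add_left psi_add_right psi_radical elim!: set_plus_elim)
qed

end

context left_leibniz_algebra
begin

text \<open>Add the left Leibniz identities for \<open>a, b, c\<close> and for
  \<open>a, c, b\<close>; the four terms on the right regroup into two values of
  \<open>psi\<close>.\<close>

lemma br_psi: "br a (psi br b c) = psi br (br a b) c + psi br b (br a c)"
  by (simp add: psi_def br_add_right left_leibniz[of a b c] left_leibniz[of a c b] algebra_simps)

lemma br_radical_right:
  assumes "x \<in> radical br"
  shows "br a x \<in> radical br"
proof -
  \<comment> \<open>In the derivation rule for \<open>psi br x b\<close>, both the left side and the
    term \<open>psi br x (br a b)\<close> vanish because \<open>x\<close> is radical.\<close>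
  have "psi br (br a x) b = 0" for b
    using br_psi[of a x b] psi_radical(1)[OF assms] by (simp add: br_zero_right)
  then show ?thesis by (simp add: radical_def)
qed

text \<open>A radical element anticommutes with everything, so this case reduces to left
  multiplication.\<close>

lemma br_radical_left:
  assumes "x \<in> radical br"
  shows "br x a \<in> radical br"
proof -
  have "br x a = - br a x"
    using psi_radical(1)[OF assms, of a] by (simp add: psi_def eq_neg_iff_add_eq_0)
  then show ?thesis
    using subspace_neg[OF subspace_radical br_radical_right[OF assms]] by simp
qed

lemma leibniz_subalgebra_add_radical:
  assumes L: "leibniz_subalgebra scale br L"
  shows "leibniz_subalgebra scale br (L + radical br)"
proof -
  have "br (a + x) (b + y) \<in> L + radical br"
    if "a \<in> L" "b \<in> L" "x \<in> radical br" "y \<in> radical br" for a b x y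
  proof -
    \<comment> \<open>Every product other than \<open>br a b\<close> has a radical factor, so the
      ideal property absorbs it.\<close>
    have "br (a + x) (b + y) = br a b + (br a y + (br x b + br x y))"
      by (simp add: br_add_left br_add_right algebra_simps)
    moreover have "br a b \<in> L"
      using L that by (simp add: leibniz_subalgebra_def)
    moreover have "br a y + (br x b + br x y) \<in> radical br"
      using that by (intro subspace_add[OF subspace_radical] br_radical_left br_radical_right)
    ultimately show ?thesis by (simp add: set_plus_intro)
  qed
  then show ?thesis
    using L by (auto simp: leibniz_subalgebra_def subspace_set_plus subspace_radical
        elim!: set_plus_elim)
qed

lemma lie_subalgebra_iff_totally_isotropic:
  assumes S: "leibniz_subalgebra scale br S"
  shows "S \<in> lie_subalgebras scale br \<longleftrightarrow> totally_isotropic_subspace scale br S"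
proof
  assume "S \<in> lie_subalgebras scale br"
  then interpret lie: lie_algebra_on scale br S by (simp add: lie_subalgebras_def)
  have "psi br a b = 0" if "a \<in> S" "b \<in> S" for a b
  proof -
    \<comment> \<open>Polarization: once the squares of \<open>a\<close> and \<open>b\<close> are
      dropped, what remains of this square is \<open>psi br a b\<close>.\<close>
    have "br (a + b) (a + b) = 0"
      using that by (intro lie.alternating subspace_add[OF lie.carrier_subspace])
    then show ?thesis
      using that by (simp add: psi_def br_add_left br_add_right lie.alternating add.commute)
  qed
  then show "totally_isotropic_subspace scale br S"
    using lie.carrier_subspace by (simp add: totally_isotropic_subspace_def)
next
  assume iso: "totally_isotropic_subspace scale br S"
  have psi0: "psi br a b = 0" if "a \<in> S" "b \<in> S" for a b
    using iso that by (simp add: totally_isotropic_subspace_def)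
  have antisym: "br b a = - br a b" if "a \<in> S" "b \<in> S" for a b
    using psi0[OF that(2,1)] by (simp add: psi_def eq_neg_iff_add_eq_0)
  have closed: "br a b \<in> S" if "a \<in> S" "b \<in> S" for a b
    using S that by (simp add: leibniz_subalgebra_def)
  have "lie_algebra_on scale br S"
  proof
    fix a b c assume abc: "a \<in> S" "b \<in> S" "c \<in> S"
    \<comment> \<open>Antisymmetry rewrites the last two cyclic terms so that the Jacobi sum becomes
      the difference of the two sides of the left Leibniz identity.\<close>
    have "br b (br c a) = - br b (br a c)"
      using antisym[OF abc(1,3)] br_scale_right[of b "-1" "br a c"] by simp
    moreover have "br c (br a b) = - br (br a b) c"
      using abc by (intro antisym closed)
    ultimately show "br a (br b c) + br b (br c a) + br c (br a b) = 0"
      using left_leibniz[of a b c] by simp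
  qed (use S psi0 in \<open>simp_all add: leibniz_subalgebra_def br_add_left br_add_right
      br_scale_left br_scale_right flip: psi_self_eq_0_iff\<close>)
  then show "S \<in> lie_subalgebras scale br"
    using S by (simp add: lie_subalgebras_def)
qed

end

theorem lemma2:
  fixes scale :: "complex \<Rightarrow> 'a::ab_group_add \<Rightarrow> 'a"
    and br :: "'a \<Rightarrow> 'a \<Rightarrow> 'a"
    and L :: "'a set"
  assumes "left_central_leibniz_algebra scale br"
    and "leibniz_subalgebra scale br L"
  shows "(L \<in> lie_subalgebras scale br \<longleftrightarrow> totally_isotropic_subspace scale br L) \<and>
         (totally_isotropic_subspace scale br L \<longleftrightarrow> L + radical br \<in> lie_subalgebras scale br)"
proof -
  interpret left_central_leibniz_algebra scale br by (fact assms(1))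
  have "subspace L"
    using assms(2) by (simp add: leibniz_subalgebra_def)
  then show ?thesis
    \<comment> \<open>The Lie criterion is applied twice, to \<open>L\<close> and to
      \<open>L + radical br\<close>, and the two isotropy conditions agree.\<close>
    by (simp add: assms(2) lie_subalgebra_iff_totally_isotropic leibniz_subalgebra_add_radical
        totally_isotropic_add_radical_iff)
qed

end
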